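(* Every operator $\mathbf{A}$ that is a (possibly empty) composition of operators from $\{\mathbf{S},\mathbf{R}\}$ respects $P$.
   Context: Notation and conventions. - Permutations of $[n]$ are in one-line notation, with composition $(\lambda\circ\sigma)(i)=\lambda(\sigma(i))$. - A sequence of distinct integers is identified with the permutation order-isomorphic to it; $n$ denotes the maximum entry. - $\mathrm{Av}(231)$ (resp. $\mathrm{Av}(132)$) is the set of permutations having no subsequence order-isomorphic to $231$ (resp. $132$). Operators. - $\mathbf{S}$ is stack sorting: $\mathbf{S}(\varepsilon)=\varepsilon$ and $\mathbf{S}(\alpha n\beta)=\mathbf{S}(\alpha)\mathbf{S}(\beta)n$, where $n$ is the maximum entry. - $\mathbf{R}$ is reversal. The bijection $P$. - $\alpha\oplus\beta=\alpha(\beta+|\alpha|)$ and $\alpha\ominus\beta=(\alpha+|\beta|)\beta$. - Every nonempty $\pi\in\mathrm{Av}(231)$ is uniquely $\alpha\oplus(1\ominus\beta)$ with $\alpha,\beta\in\mathrm{Av}(231)$. - $P:\mathrm{Av}(231)\to\mathrm{Av}(132)$ is the bijection defined by $P(\varepsilon)=\varepsilon$ and $P(\alpha\oplus(1\ominus\beta))=(P(\alpha)\oplus1)\ominus P(\beta)$. - For $\pi\in\mathrm{Av}(231)$ of size $n$, $\lambda_\pi$ is the permutation of $[n]$ with $P(\pi)=\lambda_\pi\circ\pi$. Trees. - A binary tree with integer-labelled vertices is decreasing if every child has a smaller label than its parent. - The in-order reading is defined recursively: it is (reading of left subtree)(root label)(reading of right subtree). - $\mathrm{T}_{\mathrm{in}}(\pi)$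 is the unique decreasing binary tree whose in-order reading is $\pi$. - For a permutation $\lambda$ and a tree $T$ labelled in $[n]$, $\lambda(T)$ is $T$ with each label $\ell$ replaced by $\lambda(\ell)$. Respecting $P$. An operator $\mathbf{A}$ (a composition of $\mathbf{S}$ and $\mathbf{R}$) respects $P$ if, for every $n$ and every $\pi\in\mathrm{Av}(231)$ of size $n$ lying in the image of $\mathbf{A}$: - (i) every permutation $\theta$ with $\mathbf{A}(\theta)=\pi$ satisfies $\mathbf{A}(\lambda_\pi\circ\theta)=P(\pi)$ and $\mathrm{T}_{\mathrm{in}}(\lambda_\pi\circ\theta)=\lambda_\pi(\mathrm{T}_{\mathrm{in}}(\theta))$; - (ii) the map $\theta\mapsto\lambda_\pi\circ\theta$ is a bijection from $\mathbf{A}^{-1}(\pi)$ onto $\mathbf{A}^{-1}(P(\pi))$. *)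

theory Defs
  imports
    "HOL-Library.Tree"
    "HOL-Library.Sublist"
    "HOL-Combinatorics.Combinatorics"
begin

section \<open>Permutations in one-line notation and pattern avoidance\<close>

text \<open>A permutation of \<open>{1..n}\<close> is the list of its values, so that composing a function
  \<open>f\<close> with it (on the left) is \<^term>\<open>map f\<close>, and its size is its length.\<close>

definition perms :: "nat list set" where
  "perms = (\<Union>n. permutations_of_set {1..n})"

definition order_isomorphic :: "'a::linorder list \<Rightarrow> 'b::linorder list \<Rightarrow> bool" where
  "order_isomorphic xs ys \<longleftrightarrow> length xs = length ys \<and>
     (\<forall>i<length xs. \<forall>j<length xs. xs ! i < xs ! j \<longleftrightarrow> ys ! i < ys ! j)"

definition Av :: "nat list \<Rightarrow> nat list set" where
  "Av p = {\<pi> \<in> perms. \<not> (\<exists>s. subseq s \<pi> \<and> order_isomorphic s p)}"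


section \<open>Stack sorting\<close>

text \<open>The lists \<open>\<alpha>\<close> and \<open>\<beta>\<close> are the parts before and after the (first occurrence of
  the) maximum.\<close>

function stack_sort :: "'a::linorder list \<Rightarrow> 'a list" where
  "stack_sort [] = []"
| "stack_sort (x # xs) =
     (let m = Max (set (x # xs));
          \<alpha> = takeWhile (\<lambda>y. y \<noteq> m) (x # xs);
          \<beta> = tl (dropWhile (\<lambda>y. y \<noteq> m) (x # xs))
      in stack_sort \<alpha> @ stack_sort \<beta> @ [m])"
  by pat_completeness auto

lemma length_before_Max:
  "length (takeWhile (\<lambda>y. y \<noteq> Max (set (x # xs))) (x # xs)) < length (x # xs)"
proof -
  have "takeWhile (\<lambda>y. y \<noteq> Max (set (x # xs))) (x # xs) \<noteq> x # xs"
    using Max_in[of "set (x # xs)"] unfolding takeWhile_eq_all_conv by blast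
  then show ?thesis
    using length_takeWhile_le[of "\<lambda>y. y \<noteq> Max (set (x # xs))" "x # xs"] takeWhile_eq_take
    by (metis le_neq_implies_less take_all_iff order_refl)
qed

lemma length_after_Max:
  "length (tl (dropWhile (\<lambda>y. y \<noteq> m) (x # xs))) < length (x # xs)"
  using length_dropWhile_le[of "\<lambda>y. y \<noteq> m" "x # xs"] by (simp only: length_tl) simp

termination stack_sort
  by (relation "measure length")
    (use length_before_Max length_after_Max in \<open>simp_all only: in_measure wf_measure\<close>)

lemma split_at_Max:
  fixes m :: "'a::linorder"
  assumes "\<forall>y \<in> set \<alpha> \<union> set \<beta>. y < m"
  shows "Max (set (\<alpha> @ m # \<beta>)) = m"
    and "takeWhile (\<lambda>y. y \<noteq> m) (\<alpha> @ m # \<beta>) = \<alpha>"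
    and "tl (dropWhile (\<lambda>y. y \<noteq> m) (\<alpha> @ m # \<beta>)) = \<beta>"
proof -
  show "Max (set (\<alpha> @ m # \<beta>)) = m"
    by (rule Max_eqI) (use assms in \<open>auto simp: less_imp_le\<close>)
  have "\<forall>y\<in>set \<alpha>. y \<noteq> m" using assms by auto
  then show "takeWhile (\<lambda>y. y \<noteq> m) (\<alpha> @ m # \<beta>) = \<alpha>"
    and "tl (dropWhile (\<lambda>y. y \<noteq> m) (\<alpha> @ m # \<beta>)) = \<beta>"
    by (simp_all add: takeWhile_append2 dropWhile_append2)
qed

lemma stack_sort_append_Max:
  assumes "\<forall>y \<in> set \<alpha> \<union> set \<beta>. y < m"
  shows "stack_sort (\<alpha> @ m # \<beta>) = stack_sort \<alpha> @ stack_sort \<beta> @ [m]"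
proof -
  obtain x xs where *: "\<alpha> @ m # \<beta> = x # xs" by (cases "\<alpha> @ m # \<beta>") auto
  show ?thesis
    using split_at_Max[OF assms] unfolding * stack_sort.simps Let_def by simp
qed


section \<open>The bijection from \<open>Av(231)\<close> to \<open>Av(132)\<close>\<close>

definition dsum :: "nat list \<Rightarrow> nat list \<Rightarrow> nat list" (infixl "\<oplus>" 65) where
  "\<alpha> \<oplus> \<beta> = \<alpha> @ map (\<lambda>x. x + length \<alpha>) \<beta>"

definition ssum :: "nat list \<Rightarrow> nat list \<Rightarrow> nat list" (infixl "\<ominus>" 65) where
  "\<alpha> \<ominus> \<beta> = map (\<lambda>x. x + length \<beta>) \<alpha> @ \<beta>"

text \<open>In \<open>\<alpha> \<oplus> ([1] \<ominus> \<beta>)\<close> the maximum is preceded by \<open>\<alpha>\<close> and followed by \<open>\<beta>\<close> shifted up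
  by \<open>|\<alpha>|\<close>; the recursion undoes this. The intended equation is \<open>P_decomp\<close> below; outside
  \<open>Av [2,3,1]\<close> the value of \<open>P\<close> is irrelevant.\<close>

function P :: "nat list \<Rightarrow> nat list" where
  "P [] = []"
| "P (x # xs) =
     (let m = Max (set (x # xs));
          \<alpha> = takeWhile (\<lambda>y. y \<noteq> m) (x # xs);
          \<beta> = map (\<lambda>y. y - length \<alpha>) (tl (dropWhile (\<lambda>y. y \<noteq> m) (x # xs)))
      in (P \<alpha> \<oplus> [1]) \<ominus> P \<beta>)"
  by pat_completeness auto
termination P
  by (relation "measure length")
    (use length_before_Max length_after_Max in \<open>simp_all only: in_measure wf_measure length_map\<close>)

lemma permsD:
  assumes "\<pi> \<in> perms"
  shows "distinct \<pi>" "set \<pi> = {1..length \<pi>}"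
proof -
  from assms obtain n where n: "distinct \<pi>" "set \<pi> = {1..n}"
    unfolding perms_def permutations_of_set_def by auto
  then show "distinct \<pi>" by blast
  have "length \<pi> = n" using distinct_card[OF n(1)] n(2) by simp
  with n show "set \<pi> = {1..length \<pi>}" by simp
qed

lemma permsI: "distinct \<pi> \<Longrightarrow> set \<pi> = {1..n} \<Longrightarrow> \<pi> \<in> perms"
  unfolding perms_def permutations_of_set_def by auto

lemma P_decomp:
  assumes "\<alpha> \<in> perms" "\<beta> \<in> perms"
  shows "P (\<alpha> \<oplus> ([1] \<ominus> \<beta>)) = (P \<alpha> \<oplus> [1]) \<ominus> P \<beta>"
proof -
  define m where "m = length \<alpha> + length \<beta> + 1"
  define \<gamma> where "\<gamma> = map (\<lambda>x. x + length \<alpha>) \<beta>"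
  have eq: "\<alpha> \<oplus> ([1] \<ominus> \<beta>) = \<alpha> @ m # \<gamma>"
    by (simp add: dsum_def ssum_def m_def \<gamma>_def)
  have lt: "\<forall>y \<in> set \<alpha> \<union> set \<gamma>. y < m"
    using permsD(2)[OF assms(1)] permsD(2)[OF assms(2)] by (auto simp: \<gamma>_def m_def)
  have b: "map (\<lambda>y. y - length \<alpha>) \<gamma> = \<beta>" by (simp add: \<gamma>_def comp_def)
  obtain x xs where *: "\<alpha> @ m # \<gamma> = x # xs" by (cases "\<alpha> @ m # \<gamma>") auto
  show ?thesis
    using split_at_Max[OF lt] b unfolding eq * P.simps Let_def by simp
qed

text \<open>The function \<open>\<lambda>\<^sub>\<pi>\<close>: requiring \<open>permutes\<close> makes it the identity outside \<open>{1..n}\<close>.\<close>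

definition lambda_perm :: "nat list \<Rightarrow> nat \<Rightarrow> nat" where
  "lambda_perm \<pi> = (THE f. f permutes {1..length \<pi>} \<and> map f \<pi> = P \<pi>)"

lemma Av_231_decomp:
  assumes "\<pi> \<in> Av [2,3,1]" "\<pi> \<noteq> []"
  obtains \<alpha> \<beta> where "\<alpha> \<in> Av [2,3,1]" "\<beta> \<in> Av [2,3,1]" "\<pi> = \<alpha> \<oplus> ([1] \<ominus> \<beta>)"
proof -
  define n where "n = length \<pi>"
  have pi: "\<pi> \<in> perms" and av: "\<And>s. subseq s \<pi> \<Longrightarrow> \<not> order_isomorphic s [2,3,1::nat]"
    using assms unfolding Av_def by auto
  have d: "distinct \<pi>" "set \<pi> = {1..n}" using permsD[OF pi] unfolding n_def by auto
  have "n \<in> set \<pi>" using d assms(2) by (simp add: n_def Suc_leI)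
  then obtain \<alpha> \<gamma> where split: "\<pi> = \<alpha> @ n # \<gamma>" by (meson split_list)
  have dist: "distinct \<alpha>" "distinct \<gamma>" "set \<alpha> \<inter> set \<gamma> = {}"
    "n \<notin> set \<alpha>" "n \<notin> set \<gamma>"
    using d(1) unfolding split by auto
  have len: "n = Suc (length \<alpha> + length \<gamma>)" using arg_cong[OF split, of length] unfolding n_def[symmetric] by simp
  have un: "insert n (set \<alpha> \<union> set \<gamma>) = {1..n}" using d(2) unfolding split by simp
  have un': "set \<alpha> \<union> set \<gamma> = {1..length \<alpha> + length \<gamma>}"
  proof -
    have "set \<alpha> \<union> set \<gamma> = insert n (set \<alpha> \<union> set \<gamma>) - {n}" using dist(4,5) by simp
    also have "\<dots> = {1..n} - {n}" by (simp only: un)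
    also have "\<dots> = {1..length \<alpha> + length \<gamma>}"
      unfolding len by (simp add: atLeastAtMostSuc_conv)
    finally show ?thesis .
  qed
  have less: "a < c" if "a \<in> set \<alpha>" "c \<in> set \<gamma>" for a c
  proof (rule ccontr)
    assume "\<not> a < c"
    with that dist have "c < a" by (metis disjoint_iff linorder_neqE_nat)
    have "a \<in> {1..length \<alpha> + length \<gamma>}" using that(1) un' by (metis UnI1)
    then have "a < n" using len by simp
    with \<open>c < a\<close> have iso: "order_isomorphic [a, n, c] [2,3,1::nat]"
      unfolding order_isomorphic_def by (auto simp: less_Suc_eq nth_Cons')
    have "subseq ([a] @ [n] @ [c]) (\<alpha> @ [n] @ \<gamma>)"
      using that by (intro list_emb_append_mono) (auto simp: subseq_singleton_left)
    then have "subseq [a, n, c] \<pi>" unfolding split by simp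
    with av iso show False by blast
  qed
  have seta: "set \<alpha> = {1..length \<alpha>}"
  proof -
    have down: "x \<in> set \<alpha>" if "y \<in> set \<alpha>" "1 \<le> x" "x \<le> y" for x y
    proof -
      have "y \<in> {1..length \<alpha> + length \<gamma>}" using that(1) un' by (metis UnI1)
      with that have "x \<in> {1..length \<alpha> + length \<gamma>}" by simp
      then have "x \<in> set \<alpha> \<union> set \<gamma>" by (simp only: un')
      moreover have "x \<notin> set \<gamma>" using less[OF that(1)] that(3) by (meson leD)
      ultimately show ?thesis by blast
    qed
    have ca: "card (set \<alpha>) = length \<alpha>" using dist(1) by (rule distinct_card)
    have "set \<alpha> \<subseteq> {1..length \<alpha>}"
    proof
      fix y assume y: "y \<in> set \<alpha>"
      have "{1..y} \<subseteq> set \<alpha>" using down y by auto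
      then have "y \<le> length \<alpha>" using card_mono[of "set \<alpha>" "{1..y}"] ca by simp
      moreover have "1 \<le> y" using y un' by (metis UnI1 atLeastAtMost_iff)
      ultimately show "y \<in> {1..length \<alpha>}" by simp
    qed
    then show ?thesis by (rule card_subset_eq[rotated]) (use ca in auto)
  qed
  define \<beta> where "\<beta> = map (\<lambda>x. x - length \<alpha>) \<gamma>"
  have setg: "set \<gamma> = {length \<alpha> + 1..length \<alpha> + length \<gamma>}"
  proof -
    have "set \<gamma> = (set \<alpha> \<union> set \<gamma>) - set \<alpha>" using dist(3) by blast
    also have "\<dots> = {1..length \<alpha> + length \<gamma>} - {1..length \<alpha>}"
      using un' seta by metis
    also have "\<dots> = {length \<alpha> + 1..length \<alpha> + length \<gamma>}" by auto
    finally show ?thesis .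
  qed
  have gb: "\<gamma> = map (\<lambda>x. x + length \<alpha>) \<beta>"
    unfolding \<beta>_def by (simp add: comp_def, rule map_idI[symmetric]) (use setg in auto)
  have "inj_on (\<lambda>x. x - length \<alpha>) (set \<gamma>)" by (rule inj_onI) (use setg in auto)
  then have db: "distinct \<beta>" unfolding \<beta>_def using dist by (simp add: distinct_map)
  have setb: "set \<beta> = {1..length \<beta>}"
  proof -
    have "(\<lambda>x. x + length \<alpha>) ` set \<beta> = (\<lambda>x. x + length \<alpha>) ` {1..length \<beta>}"
      using setg gb by (metis (no_types, lifting) add.commute image_add_atLeastAtMost length_map
          list.set_map image_cong)
    then show ?thesis by (subst (asm) inj_image_eq_iff) (auto intro: injI)
  qed
  have a_av: "\<alpha> \<in> Av [2,3,1]"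
  proof -
    have "subseq s \<pi>" if "subseq s \<alpha>" for s
      unfolding split using that by (rule subseq_rev_drop_many)
    then show ?thesis using av permsI[OF dist(1) seta] unfolding Av_def by auto
  qed
  have b_av: "\<beta> \<in> Av [2,3,1]"
  proof -
    have "\<not> order_isomorphic s [2,3,1::nat]" if s: "subseq s \<beta>" for s
    proof
      assume iso: "order_isomorphic s [2,3,1::nat]"
      let ?s = "map (\<lambda>x. x + length \<alpha>) s"
      have "subseq ?s \<gamma>" unfolding gb using s by (rule subseq_map)
      then have "subseq ?s \<pi>" unfolding split by (intro list_emb_append2 list_emb_Cons)
      moreover have "order_isomorphic ?s [2,3,1::nat]"
        using iso unfolding order_isomorphic_def by auto
      ultimately show False using av by blast
    qed
    then show ?thesis using permsI[OF db setb] unfolding Av_def by auto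
  qed
  have "\<pi> = \<alpha> \<oplus> ([1] \<ominus> \<beta>)"
    using split len gb by (simp add: dsum_def ssum_def)
  with a_av b_av that show ?thesis by blast
qed

lemma P_perms:
  assumes "\<pi> \<in> Av [2,3,1]"
  shows "P \<pi> \<in> perms \<and> length (P \<pi>) = length \<pi>"
  using assms
proof (induction \<pi> rule: length_induct)
  case (1 \<pi>)
  show ?case
  proof (cases "\<pi> = []")
    case True
    then show ?thesis using 1 by (auto simp: Av_def)
  next
    case False
    then obtain \<alpha> \<beta> where ab: "\<alpha> \<in> Av [2,3,1]" "\<beta> \<in> Av [2,3,1]" "\<pi> = \<alpha> \<oplus> ([1] \<ominus> \<beta>)"
      using Av_231_decomp 1 by metis
    have len: "length \<pi> = Suc (length \<alpha> + length \<beta>)"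
      unfolding ab by (simp add: dsum_def ssum_def)
    have IH: "P \<alpha> \<in> perms" "length (P \<alpha>) = length \<alpha>" "P \<beta> \<in> perms" "length (P \<beta>) = length \<beta>"
      using 1 ab len by auto
    note da = permsD[OF IH(1)] and db = permsD[OF IH(3)]
    have "\<alpha> \<in> perms" "\<beta> \<in> perms" using ab by (auto simp: Av_def)
    then have Pp: "P \<pi> = map (\<lambda>x. x + length \<beta>) (P \<alpha>) @ Suc (length \<alpha> + length \<beta>) # P \<beta>"
      using ab P_decomp IH by (simp add: dsum_def ssum_def)
    have img: "(\<lambda>x. x + length \<beta>) ` {1..length \<alpha>} = {length \<beta> + 1..length \<beta> + length \<alpha>}"
      by (auto simp: image_iff intro!: bexI[of _ "_ - length \<beta>"])
    have "set (P \<pi>) = {1..length \<pi>}"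
      unfolding Pp using da db IH len img by auto
    moreover have "distinct (P \<pi>)"
      unfolding Pp using da db IH img by (auto simp: distinct_map)
    ultimately show ?thesis using permsI Pp len IH by auto
  qed
qed

lemma lambda_perm_unique:
  assumes "\<pi> \<in> Av [2,3,1]"
  shows "\<exists>!f. f permutes {1..length \<pi>} \<and> map f \<pi> = P \<pi>"
proof -
  have pi: "\<pi> \<in> perms" using assms by (simp add: Av_def)
  note d = permsD[OF pi]
  have q: "P \<pi> \<in> perms" "length (P \<pi>) = length \<pi>" using P_perms[OF assms] by auto
  note e = permsD[OF q(1)]
  define f where "f x = (if x \<in> set \<pi> then the (map_of (zip \<pi> (P \<pi>)) x) else x)" for x
  have m: "map f \<pi> = P \<pi>"
  proof (rule nth_equalityI)
    fix i assume i: "i < length (map f \<pi>)"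
    then have "\<pi> ! i \<in> set \<pi>" by simp
    then show "map f \<pi> ! i = P \<pi> ! i"
      using map_of_zip_nth[of \<pi> "P \<pi>" i] d(1) q(2) i by (simp add: f_def)
  qed (use q in simp)
  have "f ` set \<pi> = set (P \<pi>)" using m by (metis list.set_map)
  then have im: "f ` {1..length \<pi>} = {1..length \<pi>}" using d e q by simp
  then have "inj_on f {1..length \<pi>}" by (intro eq_card_imp_inj_on) auto
  with im have "f permutes {1..length \<pi>}"
    by (intro bij_imp_permutes) (auto simp: bij_betw_def f_def d(2))
  moreover have "g = f" if g: "g permutes {1..length \<pi>}" "map g \<pi> = P \<pi>" for g
  proof
    fix x
    show "g x = f x"
    proof (cases "x \<in> set \<pi>")
      case True
      then show ?thesis using g(2) m by (metis map_eq_conv)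
    next
      case False
      then show ?thesis using g(1) d unfolding f_def by (auto dest: permutes_not_in)
    qed
  qed
  ultimately show ?thesis using m by blast
qed


section \<open>Decreasing binary trees\<close>

fun root_less :: "'a::linorder tree \<Rightarrow> 'a \<Rightarrow> bool" where
  "root_less Leaf a \<longleftrightarrow> True"
| "root_less (Node l b r) a \<longleftrightarrow> b < a"

fun decreasing :: "'a::linorder tree \<Rightarrow> bool" where
  "decreasing Leaf \<longleftrightarrow> True"
| "decreasing (Node l a r) \<longleftrightarrow> root_less l a \<and> root_less r a \<and> decreasing l \<and> decreasing r"

definition T_in :: "'a::linorder list \<Rightarrow> 'a tree" where
  "T_in \<pi> = (THE t. decreasing t \<and> inorder t = \<pi>)"

lemma decreasing_less_root:
  "decreasing t \<Longrightarrow> root_less t a \<Longrightarrow> x \<in> set (inorder t) \<Longrightarrow> x < a"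
  by (induction t arbitrary: a) force+

lemma T_in_unique:
  assumes "distinct \<pi>"
  shows "\<exists>!t. decreasing t \<and> inorder t = \<pi>"
  using assms
proof (induction \<pi> rule: length_induct)
  case (1 \<pi>)
  show ?case
  proof (cases "\<pi> = []")
    case True
    show ?thesis
      by (rule ex1I[of _ Leaf]) (use True in auto)
  next
    case False
    define m where "m = Max (set \<pi>)"
    have "m \<in> set \<pi>" using False by (simp add: m_def)
    then obtain \<alpha> \<beta> where ab: "\<pi> = \<alpha> @ m # \<beta>" by (meson split_list)
    have nm: "m \<notin> set \<alpha>" "m \<notin> set \<beta>" using 1(2) ab by auto
    have lt: "y < m" if "y \<in> set \<alpha> \<union> set \<beta>" for y
    proof -
      have "y \<le> m" unfolding m_def by (rule Max_ge) (use that ab in auto)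
      then show ?thesis using that nm by (auto simp: order.strict_iff_order)
    qed
    have "\<exists>!t. decreasing t \<and> inorder t = \<alpha>" "\<exists>!t. decreasing t \<and> inorder t = \<beta>"
      using 1 ab by auto
    then obtain l r where l: "decreasing l" "inorder l = \<alpha>" and r: "decreasing r" "inorder r = \<beta>"
      and ul: "\<And>t. decreasing t \<Longrightarrow> inorder t = \<alpha> \<Longrightarrow> t = l"
      and ur: "\<And>t. decreasing t \<Longrightarrow> inorder t = \<beta> \<Longrightarrow> t = r" by metis
    have rl: "root_less l m" using l lt by (cases l) auto
    have rr: "root_less r m" using r lt by (cases r) auto
    show ?thesis
    proof (rule ex1I[of _ "Node l m r"])
      show "decreasing (Node l m r) \<and> inorder (Node l m r) = \<pi>"
        using l r rl rr ab by simp
      fix t assume t: "decreasing t \<and> inorder t = \<pi>"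
      then obtain l' a r' where N: "t = Node l' a r'" using False by (cases t) auto
      have d: "decreasing l'" "decreasing r'" using t N by auto
      have less: "x < a" if "x \<in> set (inorder l') \<union> set (inorder r')" for x
        using t N that by (auto intro: decreasing_less_root)
      have eq: "inorder l' @ a # inorder r' = \<alpha> @ m # \<beta>" using t N ab by simp
      have "a = m" unfolding m_def
        by (rule Max_eqI[symmetric]) (use t N less in \<open>auto simp: less_imp_le\<close>)
      moreover from this have "inorder l' = \<alpha> \<and> inorder r' = \<beta>"
        using append_Cons_eq_iff[of m "inorder l'" "inorder r'" \<alpha> \<beta>] eq nm less by auto
      ultimately show "t = Node l m r" using N d ul ur by auto
    qed
  qed
qed


section \<open>Respecting the bijection\<close>

definition preimage :: "(nat list \<Rightarrow> nat list) \<Rightarrow> nat list \<Rightarrow> nat list set" where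
  "preimage A \<pi> = {\<theta> \<in> perms. A \<theta> = \<pi>}"

definition respects_P :: "(nat list \<Rightarrow> nat list) \<Rightarrow> bool" where
  "respects_P A \<longleftrightarrow>
     (\<forall>\<pi> \<in> Av [2,3,1]. \<pi> \<in> A ` perms \<longrightarrow>
        (\<forall>\<theta> \<in> preimage A \<pi>.
            A (map (lambda_perm \<pi>) \<theta>) = P \<pi> \<and>
            T_in (map (lambda_perm \<pi>) \<theta>) = map_tree (lambda_perm \<pi>) (T_in \<theta>)) \<and>
        bij_betw (map (lambda_perm \<pi>)) (preimage A \<pi>) (preimage A (P \<pi>)))"

end

theory Submission imports Defs begin

text \<open>Call \<open>f\<close> compatible with a list if \<open>f x < f y\<close> whenever \<open>y\<close> is the strict maximum of an
  interval of the list that contains \<open>x\<close>, that is, whenever \<open>y\<close> is an ancestor of \<open>x\<close> in the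
  decreasing tree. Such an \<open>f\<close> commutes with \<open>T_in\<close> and with stack sorting. In
  \<open>S(\<alpha>m\<beta>) = S(\<alpha>)S(\<beta>)m\<close> the maximum \<open>m\<close> still dominates everything before it, so a function compatible
  with \<open>S(\<theta>)\<close> is compatible with \<open>\<theta>\<close>; hence compatibility with \<open>A(\<theta>)\<close> gives compatibility
  with \<open>\<theta>\<close> and \<open>A(f \<circ> \<theta>) = f \<circ> A(\<theta>)\<close>. As \<open>\<pi>\<close> and \<open>P(\<pi>)\<close> have decreasing trees of the same
  shape, \<open>\<lambda>\<^sub>\<pi>\<close> is compatible with \<open>\<pi>\<close> and its inverse is compatible with \<open>P(\<pi>)\<close>; the former
  gives (i), and the latter gives the surjectivity in (ii).\<close>

section \<open>Functions compatible with a list\<close>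

definition compatible :: "('a::linorder \<Rightarrow> 'b::linorder) \<Rightarrow> 'a list \<Rightarrow> bool" where
  "compatible f xs \<longleftrightarrow>
     (\<forall>p u y v s. xs = p @ u @ y # v @ s \<longrightarrow> (\<forall>x \<in> set u \<union> set v. x < y) \<longrightarrow>
        (\<forall>x \<in> set u \<union> set v. f x < f y))"

lemma compatibleD:
  assumes "compatible f (p @ u @ y # v @ s)" "\<forall>x \<in> set u \<union> set v. x < y" "x \<in> set u \<union> set v"
  shows "f x < f y"
  using assms unfolding compatible_def by blast

lemma compatible_Nil [simp]: "compatible f []"
  by (simp add: compatible_def)

lemma compatible_infix:
  assumes "compatible f (p @ xs @ s)"
  shows "compatible f xs"
  unfolding compatible_def
proof (intro allI impI ballI)
  fix p' u y v s' x
  assume "xs = p' @ u @ y # v @ s'" "\<forall>x \<in> set u \<union> set v. x < y" "x \<in> set u \<union> set v"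
  then show "f x < f y"
    using compatibleD[of f "p @ p'" u y v "s' @ s"] assms by simp
qed

text \<open>Reversal only exchanges the parts \<open>u\<close> and \<open>v\<close> on either side
  of \<open>y\<close>, and the condition is symmetric in them.\<close>

lemma compatible_rev:
  assumes "compatible f (rev xs)"
  shows "compatible f xs"
  unfolding compatible_def
proof (intro allI impI ballI)
  fix p u y v s x
  assume "xs = p @ u @ y # v @ s" "\<forall>x \<in> set u \<union> set v. x < y" "x \<in> set u \<union> set v"
  then show "f x < f y"
    using compatibleD[of f "rev s" "rev v" y "rev u" "rev p" x] assms by auto
qed

lemma compatible_append_Max:
  assumes less: "\<forall>y \<in> set \<alpha> \<union> set \<beta>. y < m"
    and \<alpha>: "compatible f \<alpha>" and \<beta>: "compatible f \<beta>"
    and f: "\<forall>y \<in> set \<alpha> \<union> set \<beta>. f y < f m"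
  shows "compatible f (\<alpha> @ m # \<beta>)"
  unfolding compatible_def
proof (intro allI impI ballI)
  fix p u y v s x
  assume eq: "\<alpha> @ m # \<beta> = p @ u @ y # v @ s"
    and uv: "\<forall>x \<in> set u \<union> set v. x < y" and x: "x \<in> set u \<union> set v"
  have m: "m \<notin> set \<alpha>" "m \<notin> set \<beta>" using less by auto
  have "y \<in> set (\<alpha> @ m # \<beta>)" unfolding eq by simp
  then have "y \<le> m" using less by (auto intro: less_imp_le)
  \<comment> \<open>Entries of \<open>u\<close> and \<open>v\<close> are below \<open>y\<close>
    \<le> \<open>m\<close>, so \<open>m\<close> either equals \<open>y\<close> or lies outside the
    interval; in the latter case the whole interval sits inside \<alpha> or inside \<beta>.\<close>
  then have muv: "m \<notin> set u" "m \<notin> set v" using uv by (auto simp: not_less[symmetric])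
  have "m \<in> set (p @ u @ y # v @ s)" unfolding eq[symmetric] by simp
  then consider "y = m" | "m \<in> set p" | "m \<in> set s" using muv by auto
  then show "f x < f y"
  proof cases
    case 1
    have "\<alpha> = p @ u" "\<beta> = v @ s"
      using append_Cons_eq_iff[of m \<alpha> \<beta> "p @ u" "v @ s"] m eq 1 by auto
    then show ?thesis using f x 1 by auto
  next
    case 2
    then obtain p1 p2 where "p = p1 @ m # p2" by (meson split_list)
    then have "\<beta> = p2 @ u @ y # v @ s"
      using append_Cons_eq_iff[of m \<alpha> \<beta> p1 "p2 @ u @ y # v @ s"] m eq by auto
    then show ?thesis using compatibleD \<beta> uv x by blast
  next
    case 3
    then obtain s1 s2 where "s = s1 @ m # s2" by (meson split_list)
    then have "\<alpha> = p @ u @ y # v @ s1"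
      using append_Cons_eq_iff[of m \<alpha> \<beta> "p @ u @ y # v @ s1" s2] m eq by auto
    then show ?thesis using compatibleD \<alpha> uv x by blast
  qed
qed

lemma compatible_append_MaxD:
  assumes "compatible f (\<alpha> @ m # \<beta>)" "\<forall>y \<in> set \<alpha> \<union> set \<beta>. y < m"
  shows "compatible f \<alpha>" "compatible f \<beta>" "\<forall>y \<in> set \<alpha> \<union> set \<beta>. f y < f m"
  using compatible_infix[of f "[]" \<alpha> "m # \<beta>"] compatible_infix[of f "\<alpha> @ [m]" \<beta> "[]"]
    compatibleD[of f "[]" \<alpha> m \<beta> "[]"] assms by auto

text \<open>This is the recursion shared by \<open>stack_sort\<close> and decreasing trees: a
  nonempty distinct list splits at its maximum.\<close>

lemma distinct_Max_induct [consumes 1, case_names Nil append_Max]: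
  fixes xs :: "'a::linorder list"
  assumes "distinct xs"
    and "Q []"
    and "\<And>\<alpha> m \<beta>. distinct \<alpha> \<Longrightarrow> distinct \<beta> \<Longrightarrow> set \<alpha> \<inter> set \<beta> = {} \<Longrightarrow>
      \<forall>y \<in> set \<alpha> \<union> set \<beta>. y < m \<Longrightarrow> Q \<alpha> \<Longrightarrow> Q \<beta> \<Longrightarrow> Q (\<alpha> @ m # \<beta>)"
  shows "Q xs"
  using assms(1)
proof (induction xs rule: length_induct)
  case (1 xs)
  show ?case
  proof (cases "xs = []")
    case True
    then show ?thesis using assms(2) by simp
  next
    case False
    then have "Max (set xs) \<in> set xs" by simp
    then obtain \<alpha> \<beta> where xs: "xs = \<alpha> @ Max (set xs) # \<beta>" by (meson split_list)
    define m where "m = Max (set xs)"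
    have eq: "xs = \<alpha> @ m # \<beta>" unfolding m_def by (rule xs)
    have d: "distinct (\<alpha> @ m # \<beta>)" using 1(2) eq by simp
    have "\<forall>y \<in> set \<alpha> \<union> set \<beta>. y \<le> m" unfolding m_def using eq by (auto intro!: Max_ge)
    moreover have "m \<notin> set \<alpha> \<union> set \<beta>" using d by auto
    ultimately have "\<forall>y \<in> set \<alpha> \<union> set \<beta>. y < m" by (metis order_le_imp_less_or_eq)
    moreover have "Q \<alpha>" "Q \<beta>" using 1(1) d eq by auto
    ultimately show ?thesis unfolding eq using assms(3) d by auto
  qed
qed

section \<open>Stack sorting and decreasing trees under compatible functions\<close>

lemma mset_stack_sort: "distinct xs \<Longrightarrow> mset (stack_sort xs) = mset xs"
  by (induction xs rule: distinct_Max_induct) (simp_all add: stack_sort_append_Max)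

lemma set_stack_sort: "distinct xs \<Longrightarrow> set (stack_sort xs) = set xs"
  by (metis mset_stack_sort mset_eq_setD)

text \<open>The sorted list ends in \<open>m\<close>, so it is itself an interval dominated by
  \<open>m\<close>, which yields \<open>f y < f m\<close> for all other entries; the sorted halves
  are infixes and fall to the induction.\<close>

lemma compatible_stack_sort:
  "distinct xs \<Longrightarrow> compatible f (stack_sort xs) \<Longrightarrow> compatible f xs"
proof (induction xs rule: distinct_Max_induct)
  case (append_Max \<alpha> m \<beta>)
  have c: "compatible f (stack_sort \<alpha> @ stack_sort \<beta> @ [m])"
    using append_Max by (simp add: stack_sort_append_Max)
  have "f y < f m" if "y \<in> set \<alpha> \<union> set \<beta>" for y
    using compatibleD[of f "[]" "stack_sort \<alpha> @ stack_sort \<beta>" m "[]" "[]"] c append_Max that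
    by (auto simp: set_stack_sort)
  then show ?case
    using compatible_infix[of f "[]" "stack_sort \<alpha>" "stack_sort \<beta> @ [m]"]
      compatible_infix[of f "stack_sort \<alpha>" "stack_sort \<beta>" "[m]"] c append_Max
    by (intro compatible_append_Max) auto
qed simp

text \<open>Compatibility keeps \<open>f m\<close> the strict maximum of the image, so both lists
  split at the same position.\<close>

lemma stack_sort_map:
  "distinct xs \<Longrightarrow> compatible f xs \<Longrightarrow> stack_sort (map f xs) = map f (stack_sort xs)"
proof (induction xs rule: distinct_Max_induct)
  case (append_Max \<alpha> m \<beta>)
  note c = compatible_append_MaxD[OF append_Max.prems append_Max.hyps(4)]
  then have "\<forall>y \<in> set (map f \<alpha>) \<union> set (map f \<beta>). y < f m" by auto
  then show ?case
    using append_Max c by (simp add: stack_sort_append_Max)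
qed simp

lemma T_in_append_Max:
  assumes "distinct (\<alpha> @ m # \<beta>)" "\<forall>y \<in> set \<alpha> \<union> set \<beta>. y < m"
  shows "T_in (\<alpha> @ m # \<beta>) = Node (T_in \<alpha>) m (T_in \<beta>)"
proof -
  have "decreasing (T_in xs) \<and> inorder (T_in xs) = xs" if "distinct xs" for xs :: "'a list"
    unfolding T_in_def by (rule theI'[OF T_in_unique[OF that]])
  then have *: "decreasing (T_in \<alpha>)" "inorder (T_in \<alpha>) = \<alpha>"
    "decreasing (T_in \<beta>)" "inorder (T_in \<beta>) = \<beta>" using assms(1) by auto
  have root: "root_less t m" if "\<forall>y \<in> set (inorder t). y < m" for t
    using that by (cases t) auto
  have "decreasing (Node (T_in \<alpha>) m (T_in \<beta>)) \<and> inorder (Node (T_in \<alpha>) m (T_in \<beta>)) = \<alpha> @ m # \<beta>"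
    using * root[of "T_in \<alpha>"] root[of "T_in \<beta>"] assms(2) by simp
  then show ?thesis
    using T_in_unique[OF assms(1)] unfolding T_in_def[of "\<alpha> @ m # \<beta>"] by (rule the1_equality[rotated])
qed

lemma T_in_Nil: "T_in [] = Leaf"
  unfolding T_in_def by (rule the_equality) auto

text \<open>Here too the image splits at \<open>f m\<close>. Compatibility does not separate entries
  in different subtrees; injectivity makes the image distinct, as uniqueness of the decreasing tree
  requires.\<close>

lemma T_in_map:
  "distinct xs \<Longrightarrow> compatible f xs \<Longrightarrow> inj_on f (set xs) \<Longrightarrow>
    T_in (map f xs) = map_tree f (T_in xs)"
proof (induction xs rule: distinct_Max_induct)
  case (append_Max \<alpha> m \<beta>)
  note c = compatible_append_MaxD[OF append_Max.prems(1) append_Max.hyps(4)]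
  have d: "distinct (\<alpha> @ m # \<beta>)" using append_Max by auto
  then have "distinct (map f (\<alpha> @ m # \<beta>))" using append_Max.prems(2) distinct_map by blast
  then have "T_in (map f (\<alpha> @ m # \<beta>)) = Node (T_in (map f \<alpha>)) (f m) (T_in (map f \<beta>))"
    using c(3) T_in_append_Max[of "map f \<alpha>" "f m" "map f \<beta>"] by auto
  moreover have "inj_on f (set \<alpha>)" "inj_on f (set \<beta>)"
    using append_Max.prems(2) by (auto intro: inj_on_subset)
  ultimately show ?case
    using append_Max.IH c T_in_append_Max[OF d append_Max.hyps(4)] by simp
qed (simp add: T_in_Nil)

text \<open>Compatibility is known only for the final output, so it is pulled back through the
  outermost operator first; that operator then commutes with \<open>f\<close>, and the induction
  hypothesis handles the rest.\<close>

lemma compatible_foldr_comp: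
  assumes "set As \<subseteq> {stack_sort, rev}" "distinct \<theta>"
  defines "A \<equiv> foldr (\<circ>) As id"
  shows "mset (A \<theta>) = mset \<theta>"
    and "compatible f (A \<theta>) \<Longrightarrow> compatible f \<theta> \<and> A (map f \<theta>) = map f (A \<theta>)"
proof -
  have "mset (foldr (\<circ>) As id \<theta>) = mset \<theta> \<and>
    (compatible f (foldr (\<circ>) As id \<theta>) \<longrightarrow>
      compatible f \<theta> \<and> foldr (\<circ>) As id (map f \<theta>) = map f (foldr (\<circ>) As id \<theta>))"
    using assms(1)
  proof (induction As)
    case (Cons X As)
    have As: "set As \<subseteq> {stack_sort, rev}" using Cons.prems by simp
    define B where "B = foldr (\<circ>) As id"
    have IH: "mset (B \<theta>) = mset \<theta>"
      "compatible f (B \<theta>) \<Longrightarrow> compatible f \<theta> \<and> B (map f \<theta>) = map f (B \<theta>)"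
      using Cons.IH[OF As] unfolding B_def by blast+
    have eq: "foldr (\<circ>) (X # As) id xs = X (B xs)" for xs by (simp add: B_def)
    \<comment> \<open>The facts on \<open>stack_sort\<close> need distinct input; this is why the
      multiset claim is carried through the same induction.\<close>
    have d: "distinct (B \<theta>)" using IH(1) assms(2) by (metis mset_eq_imp_distinct_iff)
    consider "X = stack_sort" | "X = rev" using Cons.prems by auto
    then show ?case
    proof cases
      case 1
      then show ?thesis
        unfolding eq using IH d mset_stack_sort[OF d] compatible_stack_sort[OF d, of f] stack_sort_map[OF d, of f]
        by auto
    next
      case 2
      then show ?thesis unfolding eq using IH compatible_rev by (auto simp: rev_map)
    qed
  qed simp
  then show "mset (A \<theta>) = mset \<theta>"
    and "compatible f (A \<theta>) \<Longrightarrow> compatible f \<theta> \<and> A (map f \<theta>) = map f (A \<theta>)"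
    unfolding A_def by auto
qed

section \<open>Lists with decreasing trees of the same shape\<close>

text \<open>Equality of tree shapes is expressed by parallel splitting at the maxima, without
  building the trees.\<close>

inductive same_shape :: "'a::linorder list \<Rightarrow> 'b::linorder list \<Rightarrow> bool" where
  Nil: "same_shape [] []"
| append_Max: "same_shape \<alpha> \<alpha>' \<Longrightarrow> same_shape \<beta> \<beta>' \<Longrightarrow>
    \<forall>y \<in> set \<alpha> \<union> set \<beta>. y < m \<Longrightarrow> \<forall>y \<in> set \<alpha>' \<union> set \<beta>'. y < m' \<Longrightarrow>
    same_shape (\<alpha> @ m # \<beta>) (\<alpha>' @ m' # \<beta>')"

lemma same_shape_sym: "same_shape xs ys \<Longrightarrow> same_shape ys xs"
  by (induction rule: same_shape.induct) (auto intro: same_shape.intros)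

lemma same_shape_length: "same_shape xs ys \<Longrightarrow> length xs = length ys"
  by (induction rule: same_shape.induct) auto

lemma same_shape_map:
  assumes "same_shape xs ys" "strict_mono h" "strict_mono k"
  shows "same_shape (map h xs) (map k ys)"
  using assms(1)
proof (induction rule: same_shape.induct)
  case (append_Max \<alpha> \<alpha>' \<beta> \<beta>' m m')
  then show ?case
    using assms(2,3) by (auto intro!: same_shape.append_Max simp: strict_mono_less)
qed (simp add: same_shape.Nil)

text \<open>At each split the second list has maximum \<open>f m\<close>, so \<open>f\<close>
  preserves the dominance of \<open>m\<close> over both sides.\<close>

lemma same_shape_compatible: "same_shape xs ys \<Longrightarrow> ys = map f xs \<Longrightarrow> compatible f xs"
proof (induction rule: same_shape.induct)
  case (append_Max \<alpha> \<alpha>' \<beta> \<beta>' m m')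
  \<comment> \<open>Equal lengths of \<alpha> and \<open>\<alpha>'\<close> align the two
    splits.\<close>
  then have "\<alpha>' = map f \<alpha>" "m' = f m" "\<beta>' = map f \<beta>"
    using same_shape_length[OF append_Max.hyps(1)] by auto
  then show ?case using append_Max by (intro compatible_append_Max) auto
qed simp

lemma same_shape_P: "\<pi> \<in> Av [2,3,1] \<Longrightarrow> same_shape \<pi> (P \<pi>)"
proof (induction \<pi> rule: length_induct)
  case (1 \<pi>)
  show ?case
  proof (cases "\<pi> = []")
    case True
    then show ?thesis by (simp add: same_shape.Nil)
  next
    case False
    then obtain \<alpha> \<beta> where ab: "\<alpha> \<in> Av [2,3,1]" "\<beta> \<in> Av [2,3,1]" "\<pi> = \<alpha> \<oplus> ([1] \<ominus> \<beta>)"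
      using Av_231_decomp 1 by metis
    have perms: "\<alpha> \<in> perms" "\<beta> \<in> perms" using ab by (auto simp: Av_def)
    have shift: "strict_mono (\<lambda>x. x + k :: nat)" "strict_mono (\<lambda>x. x :: nat)" for k
      by (auto intro!: strict_monoI)
    have len: "length \<alpha> < length \<pi>" "length \<beta> < length \<pi>"
      unfolding ab by (auto simp: dsum_def ssum_def)
    have "same_shape \<alpha> (P \<alpha>)" "same_shape \<beta> (P \<beta>)" using 1 ab len by auto
    \<comment> \<open>The right block is shifted in \<pi> but the left block in
      \<open>P \<pi>\<close>; hence one of the two strictly monotone maps is the identity each
      time.\<close>
    then have "same_shape \<alpha> (map (\<lambda>x. x + length \<beta>) (P \<alpha>))"
      "same_shape (map (\<lambda>x. x + length \<alpha>) \<beta>) (P \<beta>)"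
      using same_shape_map[OF _ shift(2) shift(1)] same_shape_map[OF _ shift(1) shift(2)]
      by (simp_all; force)+
    moreover have PA: "P \<alpha> \<in> perms" "length (P \<alpha>) = length \<alpha>"
      and PB: "P \<beta> \<in> perms" "length (P \<beta>) = length \<beta>"
      using P_perms ab by auto
    ultimately have "same_shape (\<alpha> @ Suc (length \<alpha> + length \<beta>) # map (\<lambda>x. x + length \<alpha>) \<beta>)
      (map (\<lambda>x. x + length \<beta>) (P \<alpha>) @ Suc (length \<alpha> + length \<beta>) # P \<beta>)"
      using permsD(2)[OF perms(1)] permsD(2)[OF perms(2)] permsD(2)[OF PA(1)] permsD(2)[OF PB(1)]
      by (intro same_shape.append_Max) auto
    then show ?thesis
      unfolding ab(3) P_decomp[OF perms] using PA PB by (simp add: dsum_def ssum_def add.commute)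
  qed
qed

section \<open>Transfer to preimages and the two conditions\<close>

lemma map_permutes_perms:
  assumes "\<theta> \<in> perms" "f permutes {1..length \<theta>}"
  shows "map f \<theta> \<in> perms"
  using permsD[OF assms(1)] assms(2) permutes_inj_on[OF assms(2)]
  by (intro permsI[where n = "length \<theta>"]) (auto simp: distinct_map permutes_image)

theorem theorem4p8:
  fixes As :: "(nat list \<Rightarrow> nat list) list"
  assumes "set As \<subseteq> {stack_sort, rev}"
  shows "respects_P (foldr (\<circ>) As id)"
  unfolding respects_P_def
proof (intro ballI impI)
  fix \<pi>
  assume \<pi>: "\<pi> \<in> Av [2,3,1]"
  define A where "A = foldr (\<circ>) As id"
  define f where "f = lambda_perm \<pi>"
  define g where "g = inv f"
  have f: "f permutes {1..length \<pi>}" "map f \<pi> = P \<pi>"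
    using theI'[OF lambda_perm_unique[OF \<pi>]] unfolding f_def lambda_perm_def by auto
  have g: "g permutes {1..length \<pi>}" unfolding g_def by (rule permutes_inv[OF f(1)])
  have fg: "f \<circ> g = id" "g \<circ> f = id" unfolding g_def using permutes_inv_o[OF f(1)] by auto
  have gP: "map g (P \<pi>) = \<pi>" unfolding f(2)[symmetric] by (simp add: fg(2))
  have cf: "compatible f \<pi>"
    using same_shape_compatible[OF same_shape_P[OF \<pi>]] f(2) by simp
  \<comment> \<open>Having the same shape is symmetric, so the argument for \<open>f\<close> also
    serves its inverse.\<close>
  have cg: "compatible g (P \<pi>)"
    using same_shape_compatible[OF same_shape_sym[OF same_shape_P[OF \<pi>]]] gP by simp
  have A: "mset (A \<theta>) = mset \<theta>"
    "compatible h (A \<theta>) \<Longrightarrow> compatible h \<theta> \<and> A (map h \<theta>) = map h (A \<theta>)"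
    if "\<theta> \<in> perms" for \<theta> and h :: "nat \<Rightarrow> nat"
    using compatible_foldr_comp[OF assms permsD(1)[OF that]] unfolding A_def by auto
  \<comment> \<open>Every preimage has the size of \<pi>, so \<open>f\<close> and \<open>g\<close>
    permute exactly its set of entries.\<close>
  have len: "length \<theta> = length (A \<theta>)" if "\<theta> \<in> perms" for \<theta>
    using A(1)[OF that] mset_eq_length by metis
  have lenP: "length (P \<pi>) = length \<pi>" using P_perms[OF \<pi>] by simp
  have i: "A (map f \<theta>) = P \<pi> \<and> T_in (map f \<theta>) = map_tree f (T_in \<theta>)"
    if "\<theta> \<in> preimage A \<pi>" for \<theta>
  proof -
    have \<theta>: "\<theta> \<in> perms" "A \<theta> = \<pi>" using that by (auto simp: preimage_def)
    then have "compatible f \<theta>" "A (map f \<theta>) = P \<pi>" using A(2)[OF \<theta>(1)] cf f(2) by auto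
    then show ?thesis using T_in_map permsD(1)[OF \<theta>(1)] permutes_inj_on[OF f(1)] by blast
  qed
  have "bij_betw (map f) (preimage A \<pi>) (preimage A (P \<pi>))"
  proof (rule bij_betw_byWitness[where f' = "map g"])
    show "\<forall>\<theta> \<in> preimage A \<pi>. map g (map f \<theta>) = \<theta>"
      and "\<forall>\<theta> \<in> preimage A (P \<pi>). map f (map g \<theta>) = \<theta>"
      by (simp_all add: fg)
    show "map f ` preimage A \<pi> \<subseteq> preimage A (P \<pi>)"
      using i map_permutes_perms len f(1) by (auto simp: preimage_def)
    show "map g ` preimage A (P \<pi>) \<subseteq> preimage A \<pi>"
    proof (intro image_subsetI)
      fix \<theta>
      assume "\<theta> \<in> preimage A (P \<pi>)"
      then have \<theta>: "\<theta> \<in> perms" "A \<theta> = P \<pi>" by (auto simp: preimage_def)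
      \<comment> \<open>Compatibility of \<open>g\<close> with \<open>A \<theta> = P \<pi>\<close>
        lets \<open>A\<close> commute with \<open>g\<close> on \<theta>, and \<open>g\<close> sends
        \<open>P \<pi>\<close> back to \<pi>.\<close>
      then have "A (map g \<theta>) = \<pi>" using A(2)[OF \<theta>(1)] cg gP by auto
      moreover have "map g \<theta> \<in> perms"
        using map_permutes_perms[OF \<theta>(1)] g len[OF \<theta>(1)] lenP \<theta>(2) by simp
      ultimately show "map g \<theta> \<in> preimage A \<pi>" by (simp add: preimage_def)
    qed
  qed
  with i show "(\<forall>\<theta> \<in> preimage (foldr (\<circ>) As id) \<pi>.
        foldr (\<circ>) As id (map (lambda_perm \<pi>) \<theta>) = P \<pi> \<and>
        T_in (map (lambda_perm \<pi>) \<theta>) = map_tree (lambda_perm \<pi>) (T_in \<theta>)) \<and>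
      bij_betw (map (lambda_perm \<pi>)) (preimage (foldr (\<circ>) As id) \<pi>)
        (preimage (foldr (\<circ>) As id) (P \<pi>))"
    unfolding A_def f_def by blast
qed

end
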